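(* Let $\mathcal{GL}^F_n$ be any General Lotto game with favoritism and let $\kappa=(\gamma^A,\gamma^B)\in\mathbb{R}^2_{>0}$ satisfy $g^A(\gamma^A,\gamma^B)=0$ and $g^B(\gamma^A,\gamma^B)=0$. Then the strategy profile in which Player A draws her allocation to each battlefield $i\in[n]$ independently from $F_{A_i^\kappa}$, and Player B draws her allocation to each battlefield $i\in[n]$ independently from $F_{B_i^\kappa}$, is a (Nash) equilibrium of $\mathcal{GL}^F_n$.
   Context: **Game.** $\mathcal{GL}^F_n$ is a two-player (A and B) one-shot complete-information game with parameters: an integer $n\ge3$ (number of battlefields), budgets $0<X^A\le X^B$, $\alpha\in[0,1]$, and for each $i\in[n]=\{1,\dots,n\}$ numbers $w_i>0$, $p_i\in\mathbb{R}$, $q_i>0$. Standing assumptions: $\sum_{i}(q_iX^B-p_i)\ge X^A$, $\sum_i (X^A+p_i)/q_i\ge X^B$, and for every $i$, $q_iX^B-p_i\ge0$ and $(X^A+p_i)/q_i\ge 0$. A (mixed) strategy of Player $\phi\in\{A,B\}$ is an $n$-variate probability distribution on $\mathbb{R}^n_{\ge0}$ with marginals $(F_i^\phi)_{i\in[n]}$ such that $\sum_{i\in[n]}\mathbb{E}_{x_i\sim F_i^\phi}[x_i]\le X^\phi$ (the budget constraint is only required in expectation). Players randomize independently of each other. Let $\beta(x,y)=1$ if $x>y$, $\alpha$ if $x=y$, $0$ if $x<y$. Payoffs are the expectations of $\Pi^A=\sum_i w_i\,\beta(x_i^A,q_ix_i^B-p_i)$ and $\Pi^B=\sum_i w_i\,[1-\beta(x_i^A,q_ix_i^B-p_i)]$.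 **Functions $g^A,g^B$.** For $(\gamma^A,\gamma^B)\in\mathbb{R}^2$ let $I^+=\{j:p_j\ge0,\ \gamma^B>\frac{p_j}{q_jw_j}\}$, $I^-=\{j:p_j<0,\ \gamma^A>\frac{-p_j}{w_j}\}$, $h_i=\min\{q_iw_i\gamma^B,\ w_i\gamma^A+p_i\}$, and $$g^A(\gamma^A,\gamma^B)=\sum_{i\in I^+}\frac{h_i^2-p_i^2}{2q_iw_i}+\sum_{i\in I^-}\frac{h_i^2}{2q_iw_i}-X^B\gamma^A,$$ $$g^B(\gamma^A,\gamma^B)=\sum_{i\in I^+}\frac{(h_i-p_i)^2}{2q_iw_i}+\sum_{i\in I^-}\frac{(h_i-p_i)^2-p_i^2}{2q_iw_i}-X^A\gamma^B.$$ **Distributions $F_{A_i^\kappa},F_{B_i^\kappa}$** (cumulative distribution functions on $[0,\infty)$) for $\kappa=(\gamma^A,\gamma^B)\in\mathbb{R}^2_{>0}$: - If $p_i\ge0$ and $q_iw_i\gamma^B-p_i\le0$: $F_{A_i^\kappa}(x)=F_{B_i^\kappa}(x)=1$ for all $x\ge0$. - If $p_i\ge0$ and $0<q_iw_i\gamma^B-p_i\le w_i\gamma^A$: $F_{A_i^\kappa}(x)=\frac{p_i+x}{q_iw_i\gamma^B}$ on $[0,q_iw_i\gamma^B-p_i]$ and $1$ beyond; $F_{B_i^\kappa}(x)=1-\frac{q_i\gamma^B}{\gamma^A}+\frac{p_i}{w_i\gamma^A}$ on $[0,\frac{p_i}{q_i})$, $=1-\frac{q_i\gamma^B}{\gamma^A}+\frac{q_ix}{w_i\gamma^A}$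 on $[\frac{p_i}{q_i},w_i\gamma^B]$, and $1$ beyond. - If $p_i\ge0$ and $q_iw_i\gamma^B-p_i>w_i\gamma^A$: $F_{A_i^\kappa}(x)=1-\frac{\gamma^A}{q_i\gamma^B}+\frac{x}{q_iw_i\gamma^B}$ on $[0,w_i\gamma^A]$ and $1$ beyond; $F_{B_i^\kappa}(x)=0$ on $[0,\frac{p_i}{q_i})$, $=\frac{q_ix-p_i}{w_i\gamma^A}$ on $[\frac{p_i}{q_i},\frac{w_i\gamma^A+p_i}{q_i}]$, and $1$ beyond. - If $p_i<0$ and $w_i\gamma^A\le-p_i$: $F_{A_i^\kappa}(x)=F_{B_i^\kappa}(x)=1$ for all $x\ge0$. - If $p_i<0$ and $-p_i<w_i\gamma^A\le q_iw_i\gamma^B-p_i$: $F_{A_i^\kappa}(x)=1-\frac{\gamma^A}{q_i\gamma^B}-\frac{p_i}{q_iw_i\gamma^B}$ on $[0,-p_i)$, $=1-\frac{\gamma^A}{q_i\gamma^B}+\frac{x}{q_iw_i\gamma^B}$ on $[-p_i,w_i\gamma^A]$, and $1$ beyond; $F_{B_i^\kappa}(x)=\frac{q_ix-p_i}{w_i\gamma^A}$ on $[0,\frac{w_i\gamma^A+p_i}{q_i}]$ and $1$ beyond. - If $p_i<0$ and $w_i\gamma^A>q_iw_i\gamma^B-p_i$: $F_{A_i^\kappa}(x)=0$ on $[0,-p_i)$, $=\frac{p_i+x}{q_iw_i\gamma^B}$ on $[-p_i,q_iw_i\gamma^B-p_i]$, and $1$ beyond; $F_{B_i^\kappa}(x)=1-\frac{q_i\gamma^B}{\gamma^A}+\frac{q_ix}{w_i\gamma^A}$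 on $[0,w_i\gamma^B]$ and $1$ beyond. *)

theory Defs
  imports "HOL-Probability.Probability"
begin

definition lotto_game ::
  "nat \<Rightarrow> real \<Rightarrow> real \<Rightarrow> real \<Rightarrow> (nat \<Rightarrow> real) \<Rightarrow> (nat \<Rightarrow> real) \<Rightarrow> (nat \<Rightarrow> real) \<Rightarrow> bool" where
  "lotto_game n XA XB \<alpha> w p q \<longleftrightarrow>
     3 \<le> n \<and> 0 < XA \<and> XA \<le> XB \<and> 0 \<le> \<alpha> \<and> \<alpha> \<le> 1 \<and>
     (\<forall>i\<in>{1..n}. 0 < w i \<and> 0 < q i) \<and>
     XA \<le> (\<Sum>i\<in>{1..n}. q i * XB - p i) \<and>
     XB \<le> (\<Sum>i\<in>{1..n}. (XA + p i) / q i) \<and>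
     (\<forall>i\<in>{1..n}. 0 \<le> q i * XB - p i \<and> 0 \<le> (XA + p i) / q i)"

text \<open>
  A mixed strategy is a joint law on the coordinates \<open>{1..n}\<close>, with arbitrary correlations.
  The expectations in the budget constraint are extended nonnegative, so that an allocation of
  infinite mean is not feasible.
\<close>

definition lotto_strategies :: "nat \<Rightarrow> real \<Rightarrow> (nat \<Rightarrow> real) measure set" where
  "lotto_strategies n X =
     {M. prob_space M \<and>
         sets M = sets (\<Pi>\<^sub>M i\<in>{1..n}. (borel :: real measure)) \<and>
         (AE x in M. \<forall>i\<in>{1..n}. 0 \<le> x i) \<and>
         (\<Sum>i\<in>{1..n}. \<integral>\<^sup>+ t. ennreal t \<partial>distr M borel (\<lambda>x. x i)) \<le> ennreal X}"

definition lotto_beta :: "real \<Rightarrow> real \<Rightarrow> real \<Rightarrow> real" where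
  "lotto_beta \<alpha> x y = (if x > y then 1 else if x = y then \<alpha> else 0)"

definition payoff_A ::
  "nat \<Rightarrow> real \<Rightarrow> (nat \<Rightarrow> real) \<Rightarrow> (nat \<Rightarrow> real) \<Rightarrow> (nat \<Rightarrow> real) \<Rightarrow>
   (nat \<Rightarrow> real) measure \<Rightarrow> (nat \<Rightarrow> real) measure \<Rightarrow> real" where
  "payoff_A n \<alpha> w p q MA MB =
     (\<integral>(xA, xB). (\<Sum>i\<in>{1..n}. w i * lotto_beta \<alpha> (xA i) (q i * xB i - p i)) \<partial>(MA \<Otimes>\<^sub>M MB))"

definition payoff_B ::
  "nat \<Rightarrow> real \<Rightarrow> (nat \<Rightarrow> real) \<Rightarrow> (nat \<Rightarrow> real) \<Rightarrow> (nat \<Rightarrow> real) \<Rightarrow>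
   (nat \<Rightarrow> real) measure \<Rightarrow> (nat \<Rightarrow> real) measure \<Rightarrow> real" where
  "payoff_B n \<alpha> w p q MA MB =
     (\<integral>(xA, xB). (\<Sum>i\<in>{1..n}. w i * (1 - lotto_beta \<alpha> (xA i) (q i * xB i - p i))) \<partial>(MA \<Otimes>\<^sub>M MB))"

definition lotto_equilibrium ::
  "nat \<Rightarrow> real \<Rightarrow> real \<Rightarrow> real \<Rightarrow> (nat \<Rightarrow> real) \<Rightarrow> (nat \<Rightarrow> real) \<Rightarrow> (nat \<Rightarrow> real) \<Rightarrow>
   (nat \<Rightarrow> real) measure \<Rightarrow> (nat \<Rightarrow> real) measure \<Rightarrow> bool" where
  "lotto_equilibrium n XA XB \<alpha> w p q MA MB \<longleftrightarrow>
     MA \<in> lotto_strategies n XA \<and> MB \<in> lotto_strategies n XB \<and>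
     (\<forall>M\<in>lotto_strategies n XA. payoff_A n \<alpha> w p q M MB \<le> payoff_A n \<alpha> w p q MA MB) \<and>
     (\<forall>M\<in>lotto_strategies n XB. payoff_B n \<alpha> w p q MA M \<le> payoff_B n \<alpha> w p q MA MB)"

definition I_plus ::
  "nat \<Rightarrow> (nat \<Rightarrow> real) \<Rightarrow> (nat \<Rightarrow> real) \<Rightarrow> (nat \<Rightarrow> real) \<Rightarrow> real \<Rightarrow> nat set" where
  "I_plus n w p q \<gamma>B = {j\<in>{1..n}. p j \<ge> 0 \<and> \<gamma>B > p j / (q j * w j)}"

definition I_minus ::
  "nat \<Rightarrow> (nat \<Rightarrow> real) \<Rightarrow> (nat \<Rightarrow> real) \<Rightarrow> real \<Rightarrow> nat set" where
  "I_minus n w p \<gamma>A = {j\<in>{1..n}. p j < 0 \<and> \<gamma>A > - p j / w j}"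

definition lotto_h ::
  "(nat \<Rightarrow> real) \<Rightarrow> (nat \<Rightarrow> real) \<Rightarrow> (nat \<Rightarrow> real) \<Rightarrow> real \<Rightarrow> real \<Rightarrow> nat \<Rightarrow> real" where
  "lotto_h w p q \<gamma>A \<gamma>B i = min (q i * w i * \<gamma>B) (w i * \<gamma>A + p i)"

definition g_A ::
  "nat \<Rightarrow> real \<Rightarrow> (nat \<Rightarrow> real) \<Rightarrow> (nat \<Rightarrow> real) \<Rightarrow> (nat \<Rightarrow> real) \<Rightarrow> real \<Rightarrow> real \<Rightarrow> real" where
  "g_A n XB w p q \<gamma>A \<gamma>B =
     (\<Sum>i\<in>I_plus n w p q \<gamma>B. ((lotto_h w p q \<gamma>A \<gamma>B i)\<^sup>2 - (p i)\<^sup>2) / (2 * q i * w i)) +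
     (\<Sum>i\<in>I_minus n w p \<gamma>A. (lotto_h w p q \<gamma>A \<gamma>B i)\<^sup>2 / (2 * q i * w i)) - XB * \<gamma>A"

definition g_B ::
  "nat \<Rightarrow> real \<Rightarrow> (nat \<Rightarrow> real) \<Rightarrow> (nat \<Rightarrow> real) \<Rightarrow> (nat \<Rightarrow> real) \<Rightarrow> real \<Rightarrow> real \<Rightarrow> real" where
  "g_B n XA w p q \<gamma>A \<gamma>B =
     (\<Sum>i\<in>I_plus n w p q \<gamma>B. (lotto_h w p q \<gamma>A \<gamma>B i - p i)\<^sup>2 / (2 * q i * w i)) +
     (\<Sum>i\<in>I_minus n w p \<gamma>A. ((lotto_h w p q \<gamma>A \<gamma>B i - p i)\<^sup>2 - (p i)\<^sup>2) / (2 * q i * w i)) - XA * \<gamma>B"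

text \<open>
  Distribution functions for a single battlefield with scalar parameters \<open>w\<close>, \<open>p\<close>, \<open>q\<close>,
  extended by \<open>0\<close> to the negative half-line.
\<close>

definition F_A :: "real \<Rightarrow> real \<Rightarrow> real \<Rightarrow> real \<Rightarrow> real \<Rightarrow> real \<Rightarrow> real" where
  "F_A w p q \<gamma>A \<gamma>B x =
    (if x < 0 then 0
     else if p \<ge> 0 then
       (if q * w * \<gamma>B - p \<le> 0 then 1
        else if q * w * \<gamma>B - p \<le> w * \<gamma>A then
          (if x \<le> q * w * \<gamma>B - p then (p + x) / (q * w * \<gamma>B) else 1)
        else
          (if x \<le> w * \<gamma>A then 1 - \<gamma>A / (q * \<gamma>B) + x / (q * w * \<gamma>B) else 1))
     else
       (if w * \<gamma>A \<le> - p then 1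
        else if w * \<gamma>A \<le> q * w * \<gamma>B - p then
          (if x < - p then 1 - \<gamma>A / (q * \<gamma>B) - p / (q * w * \<gamma>B)
           else if x \<le> w * \<gamma>A then 1 - \<gamma>A / (q * \<gamma>B) + x / (q * w * \<gamma>B)
           else 1)
        else
          (if x < - p then 0
           else if x \<le> q * w * \<gamma>B - p then (p + x) / (q * w * \<gamma>B)
           else 1)))"

definition F_B :: "real \<Rightarrow> real \<Rightarrow> real \<Rightarrow> real \<Rightarrow> real \<Rightarrow> real \<Rightarrow> real" where
  "F_B w p q \<gamma>A \<gamma>B x =
    (if x < 0 then 0
     else if p \<ge> 0 then
       (if q * w * \<gamma>B - p \<le> 0 then 1
        else if q * w * \<gamma>B - p \<le> w * \<gamma>A then
          (if x < p / q then 1 - q * \<gamma>B / \<gamma>A + p / (w * \<gamma>A)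
           else if x \<le> w * \<gamma>B then 1 - q * \<gamma>B / \<gamma>A + q * x / (w * \<gamma>A)
           else 1)
        else
          (if x < p / q then 0
           else if x \<le> (w * \<gamma>A + p) / q then (q * x - p) / (w * \<gamma>A)
           else 1))
     else
       (if w * \<gamma>A \<le> - p then 1
        else if w * \<gamma>A \<le> q * w * \<gamma>B - p then
          (if x \<le> (w * \<gamma>A + p) / q then (q * x - p) / (w * \<gamma>A) else 1)
        else
          (if x \<le> w * \<gamma>B then 1 - q * \<gamma>B / \<gamma>A + q * x / (w * \<gamma>A) else 1)))"

definition independent_allocation :: "nat \<Rightarrow> (nat \<Rightarrow> real \<Rightarrow> real) \<Rightarrow> (nat \<Rightarrow> real) measure" where
  "independent_allocation n F = (\<Pi>\<^sub>M i\<in>{1..n}. interval_measure (F i))"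

text \<open>
  The junk value of \<open>interval_measure\<close> on functions that are not distribution functions does not
  occur here: \<open>F_A\<close> and \<open>F_B\<close> are the cumulative distribution functions of the laws they induce.
\<close>

lemma clamp_cdf:
  fixes F :: "real \<Rightarrow> real"
  assumes D: "D > 0" and L: "0 \<le> L" "L \<le> 1"
    and F: "\<And>x. F x = (if x < 0 then 0 else min 1 (max L ((s + x) / D)))"
  shows "real_distribution (interval_measure F) \<and> cdf (interval_measure F) = F"
proof -
  let ?G = "\<lambda>x. min 1 (max L ((s + x) / D))"
  have mono: "F x \<le> F y" if "x \<le> y" for x y
  proof -
    have "(s + x) / D \<le> (s + y) / D" using that D by (simp add: divide_right_mono)
    then have "?G x \<le> ?G y" by (auto simp: min_def max_def)
    moreover have "0 \<le> ?G y" using L by (auto simp: min_def max_def)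
    ultimately show ?thesis using that by (simp add: F)
  qed
  have cG: "continuous (at_right a) ?G" for a
    using D by (intro continuous_intros) auto
  have rc: "continuous (at_right a) F" for a
  proof (cases "a < 0")
    case True
    have "eventually (\<lambda>x. F x = 0) (at_right a)"
      using eventually_at_right_less[of a] True
      by (auto simp: eventually_at_right_field F intro!: exI[of _ 0])
    then show ?thesis using True
      by (simp add: continuous_within F tendsto_eventually)
  next
    case False
    have "eventually (\<lambda>x. ?G x = F x) (at_right a)"
      using False by (auto simp: eventually_at_right_field F intro!: exI[of _ "a+1"])
    moreover have "(?G \<longlongrightarrow> F a) (at_right a)"
      using cG[of a] False by (simp add: continuous_within F)
    ultimately show ?thesis
      unfolding continuous_within by (blast intro: Lim_transform_eventually)
  qed
  have bot: "(F \<longlongrightarrow> 0) at_bot"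
    by (rule tendsto_eventually) (auto simp: eventually_at_bot_dense F intro!: exI[of _ 0])
  have top: "(F \<longlongrightarrow> 1) at_top"
  proof (rule tendsto_eventually, unfold eventually_at_top_linorder, intro exI allI impI)
    fix x assume x: "max 0 (D - s) \<le> x"
    then have "1 \<le> (s + x) / D" using D by (simp add: field_simps)
    then show "F x = 1" using x by (simp add: F)
  qed
  show ?thesis
    using real_distribution_interval_measure[OF mono rc bot top]
      cdf_interval_measure[OF mono rc bot] by blast
qed

lemma F_A_cdf:
  assumes "w > 0" "q > 0" "\<gamma>A > 0" "\<gamma>B > 0"
  shows "real_distribution (interval_measure (F_A w p q \<gamma>A \<gamma>B)) \<and>
     cdf (interval_measure (F_A w p q \<gamma>A \<gamma>B)) = F_A w p q \<gamma>A \<gamma>B"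
proof -
  let ?D = "q * w * \<gamma>B"
  have D: "?D > 0" using assms by simp
  note * = clamp_cdf[OF D, of _ "F_A w p q \<gamma>A \<gamma>B"]
  have e: "1 - \<gamma>A / (q * \<gamma>B) + x / ?D = (?D - w*\<gamma>A + x) / ?D" for x
    using assms by (simp add: field_simps)
  have e': "1 - \<gamma>A / (q * \<gamma>B) - p / ?D = (?D - w*\<gamma>A - p) / ?D"
    using e[of "-p"] by simp
  have m: "min 1 (max L (y / ?D)) = (if y \<ge> ?D then 1 else max L (y / ?D))" if "L \<le> 1" for L y
  proof (cases "y \<ge> ?D")
    case True then have "1 \<le> y / ?D" using D by (subst le_divide_eq_1_pos)
    then show ?thesis using True by simp
  next
    case False then have "y / ?D < 1" using D by (subst divide_less_eq_1_pos) auto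
    then show ?thesis using that False by simp
  qed
  have wA: "w*\<gamma>A > 0" using assms by simp
  consider "p \<ge> 0 \<and> ?D - p \<le> 0 \<or> p < 0 \<and> w * \<gamma>A \<le> - p"
    | "p \<ge> 0" "?D - p > 0" "?D - p \<le> w * \<gamma>A" | "p \<ge> 0" "?D - p > 0" "?D - p > w * \<gamma>A"
    | "p < 0" "w * \<gamma>A > - p" "w * \<gamma>A \<le> ?D - p" | "p < 0" "w * \<gamma>A > - p" "w * \<gamma>A > ?D - p"
    by linarith
  then show ?thesis
  proof cases
    case 1 then show ?thesis by (intro *[of 1 0]) (auto simp: F_A_def)
  next
    case 2 then show ?thesis 
      using D by (intro *[of 0 p]) (auto simp: F_A_def m max_def divide_le_0_iff)
  next
    case 3 then show ?thesis 
      using D wA by (intro *[of 0 "?D - w*\<gamma>A"]) (auto simp: F_A_def m e max_def divide_le_0_iff)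
  next
    case 4 then show ?thesis 
      using D wA by (intro *[of "(?D - w*\<gamma>A - p) / ?D" "?D - w*\<gamma>A"])
        (auto simp: F_A_def m e e' max_def divide_le_cancel)
  next
    case 5 then show ?thesis 
      using D wA by (intro *[of 0 p]) (auto simp: F_A_def m max_def divide_le_0_iff zero_le_divide_iff)
  qed
qed

lemma F_B_cdf:
  assumes "w > 0" "q > 0" "\<gamma>A > 0" "\<gamma>B > 0"
  shows "real_distribution (interval_measure (F_B w p q \<gamma>A \<gamma>B)) \<and>
     cdf (interval_measure (F_B w p q \<gamma>A \<gamma>B)) = F_B w p q \<gamma>A \<gamma>B"
proof -
  let ?D = "w * \<gamma>A / q"
  have D: "?D > 0" using assms by simp
  note * = clamp_cdf[OF D, of _ "F_B w p q \<gamma>A \<gamma>B"]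
  have e: "1 - q * \<gamma>B / \<gamma>A + q * x / (w * \<gamma>A) = (?D - w*\<gamma>B + x) / ?D" for x
    using assms by (simp add: field_simps)
  have e': "1 - q * \<gamma>B / \<gamma>A + p / (w * \<gamma>A) = (?D - w*\<gamma>B + p/q) / ?D"
    using e[of "p/q"] assms by simp
  have e'': "(q * x - p) / (w * \<gamma>A) = (- p/q + x) / ?D" for x
    using assms by (simp add: field_simps)
  have m: "min 1 (max L (y / ?D)) = (if y \<ge> ?D then 1 else max L (y / ?D))" if "L \<le> 1" for L y
  proof (cases "y \<ge> ?D")
    case True then have "1 \<le> y / ?D" using D by (subst le_divide_eq_1_pos)
    then show ?thesis using True by simp
  next
    case False then have "y / ?D < 1" using D by (subst divide_less_eq_1_pos) auto
    then show ?thesis using that False by simp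
  qed
  have wB: "w*\<gamma>B > 0" using assms by simp
  have pos: "y / D \<le> 0 \<longleftrightarrow> y \<le> 0" "0 \<le> y / D \<longleftrightarrow> 0 \<le> y" "y / D \<le> 1 \<longleftrightarrow> y \<le> D"
     "y / D \<le> z / D \<longleftrightarrow> y \<le> z" "D / D = 1" if "D > 0" for y z D :: real
    using that by (auto simp: divide_le_0_iff zero_le_divide_iff divide_le_cancel)
  note d0 = pos[OF D]
  obtain r where r: "r = p / q" by simp
  obtain D where Dd: "D = ?D" by simp
  have c: "q * w * \<gamma>B - p \<le> 0 \<longleftrightarrow> w*\<gamma>B \<le> r" "q * w * \<gamma>B - p \<le> w * \<gamma>A \<longleftrightarrow> w*\<gamma>B - r \<le> D"
     "w * \<gamma>A \<le> - p \<longleftrightarrow> D \<le> - r" "w * \<gamma>A \<le> q * w * \<gamma>B - p \<longleftrightarrow> D \<le> w*\<gamma>B - r"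
     "(w * \<gamma>A + p) / q = D + r" "p \<ge> 0 \<longleftrightarrow> r \<ge> 0" "-p/q = -r"
  proof -
    have p: "p = q * r" and wD: "w * \<gamma>A = q * D" using assms r Dd by auto
    have qp: "q * x \<le> q * y \<longleftrightarrow> x \<le> y" for x y using assms by simp
    have "q * w * \<gamma>B - p = q * (w * \<gamma>B - r)" by (simp add: p algebra_simps)
    then show "q * w * \<gamma>B - p \<le> w * \<gamma>A \<longleftrightarrow> w*\<gamma>B - r \<le> D"
      "w * \<gamma>A \<le> q * w * \<gamma>B - p \<longleftrightarrow> D \<le> w*\<gamma>B - r"
      "q * w * \<gamma>B - p \<le> 0 \<longleftrightarrow> w*\<gamma>B \<le> r"
      using qp[of _ 0] qp[of "w * \<gamma>B - r" 0] by (simp_all only: wD qp) (use assms in \<open>auto simp: mult_le_0_iff\<close>)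
    show "w * \<gamma>A \<le> - p \<longleftrightarrow> D \<le> - r" using qp[of D "-r"] by (simp add: wD p)
  qed (use assms in \<open>auto simp: r Dd field_simps zero_le_divide_iff\<close>)
  note * = *[folded Dd] note d0 = d0[folded Dd] note m = m[folded Dd]
  note FB = F_B_def[of w p q \<gamma>A \<gamma>B, unfolded e e' e'' c, folded r Dd]
  note D = D[folded Dd]
  consider "r \<ge> 0 \<and> w*\<gamma>B \<le> r \<or> r < 0 \<and> D \<le> - r"
    | "r \<ge> 0" "w*\<gamma>B > r" "w*\<gamma>B - r \<le> D" | "r \<ge> 0" "w*\<gamma>B > r" "w*\<gamma>B - r > D"
    | "r < 0" "D > - r" "D \<le> w*\<gamma>B - r" | "r < 0" "D > - r" "D > w*\<gamma>B - r"
    by linarith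
  then show ?thesis
  proof cases
    case 1 then show ?thesis by (intro *[of 1 0]) (auto simp: FB)
  next
    case 2 then show ?thesis 
      using D wB by (intro *[of "(D - w*\<gamma>B + r)/D" "D - w*\<gamma>B"]) (auto simp: FB m max_def d0)
  next
    case 3 then show ?thesis 
      using D wB by (intro *[of 0 "-r"]) (auto simp: FB m max_def d0)
  next
    case 4 then show ?thesis 
      using D wB by (intro *[of 0 "-r"]) (auto simp: FB m max_def d0)
  next
    case 5 then show ?thesis 
      using D wB by (intro *[of 0 "D - w*\<gamma>B"]) (auto simp: FB m max_def d0)
  qed
qed

end

theory Submission
  imports Defs
begin

text \<open>
  On every battlefield the probability of winning against the equilibrium law is bounded by an
  affine function of the allocation, with slope \<open>1 / \<gamma>A\<close> for Player A and \<open>1 / \<gamma>B\<close> for Player B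
  after multiplication by the value of the battlefield. Since the budget only binds in
  expectation, integrating these bounds limits what any strategy, however correlated, can gain:
  at most \<open>V\<close> for A against the candidate of B and at most \<open>U\<close> for B against the candidate of A.
  The equations \<open>g_A = g_B = 0\<close> say that the candidates exhaust the two budgets, and with that
  \<open>V + U\<close> equals the sum of the values. The game being constant-sum, both bounds are attained by
  the candidates themselves, so that ties never have to be evaluated.
\<close>

section \<open>Means read off from distribution functions\<close>

text \<open>Layer-cake formula: \<open>x\<close> is the length of \<open>{0..<x}\<close>, and Fubini
  exchanges the two integrals. Negative \<open>x\<close> contribute nothing on either side, since
  \<open>ennreal\<close> sends them to \<open>0\<close>.\<close>

lemma nn_integral_eq_tail:
  fixes M :: "real measure"
  assumes "real_distribution M"
  shows "(\<integral>\<^sup>+ x. ennreal x \<partial>M) = (\<integral>\<^sup>+ t. ennreal (1 - cdf M t) * indicator {0..} t \<partial>lborel)"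
proof -
  interpret real_distribution M by fact
  interpret pair_sigma_finite M lborel ..
  have tail: "emeasure M {t<..} = ennreal (1 - cdf M t)" for t
  proof -
    have "{t<..} = space M - {..t}" by auto
    then show ?thesis
      using prob_compl[of "{..t}"] by (simp add: emeasure_eq_measure cdf_def)
  qed
  have "(\<integral>\<^sup>+ x. ennreal x \<partial>M) = (\<integral>\<^sup>+ x. emeasure lborel {0..<x} \<partial>M)"
  proof (intro nn_integral_cong)
    show "ennreal x = emeasure lborel {0..<x}" for x
      by (cases "0 \<le> x") (auto simp: ennreal_neg)
  qed
  also have "\<dots> = (\<integral>\<^sup>+ x. (\<integral>\<^sup>+ t. indicator {0..} t * indicator {t<..} x \<partial>lborel) \<partial>M)"
  proof (intro nn_integral_cong)
    fix x :: real
    have "emeasure lborel {0..<x} = (\<integral>\<^sup>+ t. indicator {0..<x} t \<partial>lborel)"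
      by simp
    also have "\<dots> = (\<integral>\<^sup>+ t. indicator {0..} t * indicator {t<..} x \<partial>lborel)"
      by (intro nn_integral_cong) (auto split: split_indicator)
    finally show "emeasure lborel {0..<x} = (\<integral>\<^sup>+ t. indicator {0..} t * indicator {t<..} x \<partial>lborel)" .
  qed
  also have "\<dots> = (\<integral>\<^sup>+ t. (\<integral>\<^sup>+ x. indicator {0..} t * indicator {t<..} x \<partial>M) \<partial>lborel)"
    by (rule Fubini'[symmetric]) (simp add: indicator_def[abs_def])
  also have "\<dots> = (\<integral>\<^sup>+ t. ennreal (1 - cdf M t) * indicator {0..} t \<partial>lborel)"
    by (intro nn_integral_cong) (simp add: nn_integral_cmult_indicator tail mult.commute)
  finally show ?thesis .
qed

text \<open>The tail \<open>1 - F\<close> is a rectangle of height \<open>1 - L\<close> over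
  \<open>{0..<a}\<close> followed by a line of slope \<open>- 1 / D\<close> that reaches
  \<open>0\<close> at \<open>b\<close>; the mean is the sum of the two areas.\<close>

lemma nn_integral_ramp:
  fixes F :: "real \<Rightarrow> real"
  assumes F: "real_distribution (interval_measure F)" "cdf (interval_measure F) = F"
    and ab: "0 \<le> a" "a \<le> b" and D: "0 < D" and L: "L \<le> 1"
    and shape: "\<And>x. 0 \<le> x \<Longrightarrow> F x = (if x < a then L else if x \<le> b then 1 - (b - x) / D else 1)"
  shows "(\<integral>\<^sup>+ x. ennreal x \<partial>interval_measure F) = ennreal (a * (1 - L) + (b - a)\<^sup>2 / (2 * D))"
proof -
  have ramp: "(\<integral>\<^sup>+ t. ennreal ((b - t) / D) * indicator {a..b} t \<partial>lborel) = ennreal ((b - a)\<^sup>2 / (2 * D))"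
  proof -
    have "(\<integral>\<^sup>+ t. ennreal ((b - t) / D) * indicator {a..b} t \<partial>lborel)
        = ennreal (- (b - b)\<^sup>2 / (2 * D) - (- (b - a)\<^sup>2 / (2 * D)))"
      using ab D
      by (intro nn_integral_FTC_Icc) (auto intro!: derivative_eq_intros simp: field_simps)
    then show ?thesis by simp
  qed
  have "(\<integral>\<^sup>+ x. ennreal x \<partial>interval_measure F) =
      (\<integral>\<^sup>+ t. ennreal (1 - L) * indicator {0..<a} t + ennreal ((b - t) / D) * indicator {a..b} t \<partial>lborel)"
    unfolding nn_integral_eq_tail[OF F(1)] F(2)
    using ab by (intro nn_integral_cong) (auto simp: shape split: split_indicator)
  also have "\<dots> = ennreal (1 - L) * ennreal a + ennreal ((b - a)\<^sup>2 / (2 * D))"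
    using ab by (subst nn_integral_add) (auto simp: nn_integral_cmult_indicator ramp)
  also have "\<dots> = ennreal (a * (1 - L) + (b - a)\<^sup>2 / (2 * D))"
    using ab D L by (simp add: ennreal_mult[symmetric] ennreal_plus[symmetric] mult.commute del: ennreal_plus)
  finally show ?thesis .
qed

section \<open>Laws, means and winning bounds on a single battlefield\<close>

text \<open>
  In terms of \<open>D = q w \<gamma>B\<close>, \<open>E = w \<gamma>A\<close> and \<open>h = min D (E + p)\<close> the six cases of \<open>F_A\<close> and \<open>F_B\<close>
  collapse: the battlefield is contested iff \<open>h > max 0 p\<close>, and then each law is a
  possible atom at \<open>0\<close> followed by a uniform part.
\<close>

definition ramp_mean_A :: "real \<Rightarrow> real \<Rightarrow> real \<Rightarrow> real" where
  "ramp_mean_A p h D =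
    (if h \<le> max 0 p then 0
     else if p \<ge> 0 then (h - p)\<^sup>2 / (2 * D)
     else ((h - p)\<^sup>2 - p\<^sup>2) / (2 * D))"

definition ramp_mean_B :: "real \<Rightarrow> real \<Rightarrow> real \<Rightarrow> real \<Rightarrow> real" where
  "ramp_mean_B p q h E =
    (if h \<le> max 0 p then 0
     else if p \<ge> 0 then (h\<^sup>2 - p\<^sup>2) / (2 * q * E)
     else h\<^sup>2 / (2 * q * E))"

context
  fixes w p q \<gamma>A \<gamma>B D E h :: real
  assumes pos: "w > 0" "q > 0" "\<gamma>A > 0" "\<gamma>B > 0"
    and D: "D = q * w * \<gamma>B" and E: "E = w * \<gamma>A" and h: "h = min D (E + p)"
begin

private lemma D_pos: "0 < D" and E_pos: "0 < E"
  using pos by (simp_all add: D E)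

text \<open>For \<open>p \<ge> 0\<close> the branch \<open>x < - p\<close> is empty once
  \<open>x \<ge> 0\<close>. For a contested battlefield with \<open>p < 0\<close> its value
  \<open>1 - h / D\<close> is \<open>0\<close> exactly when \<open>h = D\<close>, which recovers the
  law without an atom.\<close>

lemma F_A_ramp:
  "F_A w p q \<gamma>A \<gamma>B x =
    (if x < 0 then 0 else if h \<le> max 0 p then 1 else if x < - p then 1 - h / D
     else if x \<le> h - p then 1 - (h - p - x) / D else 1)"
proof -
  have eqs: "1 - \<gamma>A / (q * \<gamma>B) + z / D = 1 - (E - z) / D"
    "1 - \<gamma>A / (q * \<gamma>B) - p / D = 1 - (E + p) / D"
    "(p + z) / D = 1 - (D - p - z) / D" for z
    using pos by (simp_all add: D E field_simps)
  show ?thesis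
    unfolding F_A_def D[symmetric] E[symmetric] eqs h
    using D_pos E_pos by (auto simp: min_def max_def)
qed

lemma F_B_ramp:
  "F_B w p q \<gamma>A \<gamma>B x =
    (if x < 0 then 0 else if h \<le> max 0 p then 1 else if x < p / q then 1 - (h - p) / E
     else if x \<le> h / q then 1 - (h - q * x) / E else 1)"
proof -
  have eqs: "1 - q * \<gamma>B / \<gamma>A + q * z / E = 1 - (D - q * z) / E"
    "1 - q * \<gamma>B / \<gamma>A + p / E = 1 - (D - p) / E"
    "(q * z - p) / E = 1 - (E + p - q * z) / E" "w * \<gamma>B = D / q" for z
    using pos by (simp_all add: D E field_simps)
  have "x \<le> z / q \<longleftrightarrow> q * x \<le> z" "x < z / q \<longleftrightarrow> q * x < z" for z
    using pos by (simp_all add: field_simps)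
  moreover have "\<not> q * x < p" if "p < 0" "0 \<le> x"
    using that mult_nonneg_nonneg[of q x] pos by linarith
  ultimately show ?thesis
    unfolding F_B_def D[symmetric] E[symmetric] eqs h
    using D_pos E_pos by (auto simp: min_def max_def)
qed

lemma ramp_mean_A_nonneg: "0 \<le> ramp_mean_A p h D"
proof -
  have "(h - p)\<^sup>2 - p\<^sup>2 = h * (h - 2 * p)" by (simp add: power2_eq_square algebra_simps)
  then show ?thesis
    using D_pos by (auto simp: ramp_mean_A_def)
qed

lemma ramp_mean_B_nonneg: "0 \<le> ramp_mean_B p q h E"
  using pos E_pos by (auto simp: ramp_mean_B_def intro!: divide_nonneg_pos power_mono)

lemma nn_integral_F_A:
  "(\<integral>\<^sup>+ x. ennreal x \<partial>interval_measure (F_A w p q \<gamma>A \<gamma>B)) = ennreal (ramp_mean_A p h D)"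
proof -
  note ramp = nn_integral_ramp[OF F_A_cdf[OF pos, THEN conjunct1] F_A_cdf[OF pos, THEN conjunct2]]
  consider "h \<le> max 0 p" | "h > max 0 p" by linarith
  then show ?thesis
  proof cases
    case 1
    then show ?thesis
      \<comment> \<open>The point mass at \<open>0\<close> is the degenerate ramp with
        \<open>a = b = 0\<close>.\<close>
      by (subst ramp[of 0 0 1 0]) (auto simp: F_A_ramp ramp_mean_A_def)
  next
    case 2
    then have "(\<integral>\<^sup>+ x. ennreal x \<partial>interval_measure (F_A w p q \<gamma>A \<gamma>B)) =
        ennreal (max 0 (- p) * (1 - (1 - h / D)) + (h - p - max 0 (- p))\<^sup>2 / (2 * D))"
      using D_pos by (intro ramp) (auto simp: F_A_ramp)
    also have "max 0 (- p) * (1 - (1 - h / D)) + (h - p - max 0 (- p))\<^sup>2 / (2 * D) = ramp_mean_A p h D"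
      using 2 D_pos by (auto simp: ramp_mean_A_def max_def field_simps power2_eq_square)
    finally show ?thesis .
  qed
qed

lemma nn_integral_F_B:
  "(\<integral>\<^sup>+ x. ennreal x \<partial>interval_measure (F_B w p q \<gamma>A \<gamma>B)) = ennreal (ramp_mean_B p q h E)"
proof -
  note ramp = nn_integral_ramp[OF F_B_cdf[OF pos, THEN conjunct1] F_B_cdf[OF pos, THEN conjunct2]]
  consider "h \<le> max 0 p" | "h > max 0 p" by linarith
  then show ?thesis
  proof cases
    case 1
    then show ?thesis
      by (subst ramp[of 0 0 1 0]) (auto simp: F_B_ramp ramp_mean_B_def)
  next
    case 2
    \<comment> \<open>The flat part must end at a nonnegative point, so \<open>p / q\<close> is
      replaced by \<open>max 0 (p / q)\<close>; on \<open>x \<ge> 0\<close> this changes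
      nothing.\<close>
    have less: "x < max 0 (p / q) \<longleftrightarrow> x < p / q" if "0 \<le> x" for x
      using that by auto
    \<comment> \<open>In the variable \<open>x\<close> the ramp of \<open>F_B\<close> has slope
      \<open>q / E\<close>, so \<open>E / q\<close> takes the role of the denominator
      \<open>D\<close> of the ramp formula.\<close>
    have "(h - q * x) / E = (h / q - x) / (E / q)" for x
      using pos E_pos by (simp add: field_simps)
    with 2 have "(\<integral>\<^sup>+ x. ennreal x \<partial>interval_measure (F_B w p q \<gamma>A \<gamma>B)) =
        ennreal (max 0 (p / q) * (1 - (1 - (h - p) / E)) + (h / q - max 0 (p / q))\<^sup>2 / (2 * (E / q)))"
      using E_pos pos by (intro ramp) (auto simp: F_B_ramp less divide_right_mono)
    also have "max 0 (p / q) * (1 - (1 - (h - p) / E)) + (h / q - max 0 (p / q))\<^sup>2 / (2 * (E / q))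
        = ramp_mean_B p q h E"
    proof (cases "p \<ge> 0")
      case True
      then have "max 0 (p / q) = p / q" using pos by simp
      then show ?thesis
        using 2 True E_pos pos by (simp add: ramp_mean_B_def divide_simps power2_eq_square) (simp add: algebra_simps)
    next
      case False
      then have "max 0 (p / q) = 0" using pos by (simp add: max_def zero_le_divide_iff)
      then show ?thesis
        using 2 False E_pos pos by (simp add: ramp_mean_B_def field_simps power2_eq_square)
    qed
    finally show ?thesis .
  qed
qed

text \<open>Each line extends the ramp of the opponent's law, or touches its jump on an uncontested
  battlefield. The slopes \<open>1 / \<gamma>A\<close> and \<open>1 / \<gamma>B\<close> act as
  Lagrange multipliers of the budgets and are common to all battlefields. The last identity says
  that the two lines, evaluated at the candidates' own means, share out exactly
  \<open>w\<close>.\<close>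

lemma affine_majorants:
  obtains cA cB where
    "\<And>x. 0 \<le> x \<Longrightarrow> w * F_B w p q \<gamma>A \<gamma>B ((x + p) / q) \<le> cA + 1 / \<gamma>A * x"
    "\<And>y. 0 \<le> y \<Longrightarrow> w * F_A w p q \<gamma>A \<gamma>B (q * y - p) \<le> cB + 1 / \<gamma>B * y"
    "cA + cB + ramp_mean_A p h D / \<gamma>A + ramp_mean_B p q h E / \<gamma>B = w"
proof -
  \<comment> \<open>The statement divided by \<open>w\<close>, which turns the slopes into
    \<open>1 / E\<close> and \<open>q / D\<close>.\<close>
  have "\<exists>c d. (\<forall>x\<ge>0. F_B w p q \<gamma>A \<gamma>B ((x + p) / q) \<le> c + x / E) \<and>
      (\<forall>y\<ge>0. F_A w p q \<gamma>A \<gamma>B (q * y - p) \<le> d + q * y / D) \<and>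
      c + d + ramp_mean_A p h D / E + q * ramp_mean_B p q h E / D = 1"
  proof (cases "h \<le> max 0 p")
    case True
    then consider "p \<ge> 0" "D \<le> p" | "p < 0" "E \<le> - p"
      using D_pos E_pos by (cases "p \<ge> 0") (auto simp: h)
    then show ?thesis
    proof cases
      case 1
      \<comment> \<open>Here A wins for sure when both allocate \<open>0\<close>. B gets nothing
        unless \<open>q * y \<ge> p \<ge> D\<close>, and by then \<open>q * y / D\<close> has
        reached \<open>1\<close>.\<close>
      with True show ?thesis
        using D_pos E_pos pos
        by (intro exI[of _ 1] exI[of _ 0]) (auto simp: F_A_ramp F_B_ramp ramp_mean_A_def ramp_mean_B_def)
    next
      case 2
      \<comment> \<open>Mirror image: A gets nothing unless \<open>x \<ge> - p \<ge> E\<close>,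
        where \<open>x / E\<close> is at least \<open>1\<close>.\<close>
      with True show ?thesis
        using D_pos E_pos pos
        by (intro exI[of _ 0] exI[of _ 1])
          (auto simp: F_A_ramp F_B_ramp ramp_mean_A_def ramp_mean_B_def zero_le_divide_iff divide_less_0_iff)
    qed
  next
    case False
    have hD: "h \<le> D" and hE: "h - p \<le> E" and tight: "h = D \<or> h - p = E"
      by (auto simp: h min_def)
    \<comment> \<open>The values at \<open>x = 0\<close> and \<open>y = 0\<close> of the ramps of
      \<open>F_B\<close> and \<open>F_A\<close>, extended as affine functions. They are nonnegative,
      so the lines stay above the laws also where these vanish.\<close>
    define c d where "c = 1 - (h - p) / E" and "d = 1 - h / D"
    have c: "0 \<le> c" and d: "0 \<le> d"
      using hD hE D_pos E_pos by (auto simp: c_def d_def)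
    have "F_B w p q \<gamma>A \<gamma>B ((x + p) / q) \<le> c + x / E" if x: "0 \<le> x" for x
    proof -
      have "c + x / E = 1 - (h - (x + p)) / E" by (simp add: c_def diff_divide_distrib add_divide_distrib)
      moreover have "0 \<le> x / E" using x E_pos by simp
      moreover have "h < x + p \<Longrightarrow> 0 \<le> - ((h - (x + p)) / E)"
        using E_pos by (simp add: divide_nonpos_pos)
      ultimately show ?thesis
        using False x c pos by (auto simp: F_B_ramp divide_le_cancel divide_less_cancel)
    qed
    moreover have "F_A w p q \<gamma>A \<gamma>B (z - p) \<le> d + z / D" if z: "0 \<le> z" for z
    proof -
      have "d + z / D = 1 - (h - z) / D" by (simp add: d_def diff_divide_distrib)
      moreover have "0 \<le> z / D" using z D_pos by simp
      moreover have "h < z \<Longrightarrow> 0 \<le> - ((h - z) / D)"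
        using D_pos by (simp add: divide_nonpos_pos)
      ultimately show ?thesis
        using False z d by (auto simp: F_A_ramp)
    qed
    then have "F_A w p q \<gamma>A \<gamma>B (q * y - p) \<le> d + q * y / D" if "0 \<le> y" for y
      using that pos by simp
    moreover have "c + d + ramp_mean_A p h D / E + q * ramp_mean_B p q h E / D = 1"
    proof -
      \<comment> \<open>The two signs of \<open>p\<close> place the term \<open>p\<^sup>2\<close> in
        different means, but the total is the same.\<close>
      have "ramp_mean_A p h D / E + q * ramp_mean_B p q h E / D = h * (h - p) / (D * E)"
        using False D_pos E_pos pos
        by (auto simp: ramp_mean_A_def ramp_mean_B_def field_simps power2_eq_square)
      moreover have "c + d + h * (h - p) / (D * E) - 1 = c * d"
        using D_pos E_pos by (simp add: c_def d_def field_simps)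
      \<comment> \<open>The minimum \<open>h\<close> equals one of its two arguments, so one of the
        intercepts vanishes.\<close>
      moreover have "c * d = 0"
        using tight D_pos E_pos by (auto simp: c_def d_def)
      ultimately show ?thesis by simp
    qed
    ultimately show ?thesis by blast
  qed
  then obtain c d where
    c: "\<And>x. 0 \<le> x \<Longrightarrow> F_B w p q \<gamma>A \<gamma>B ((x + p) / q) \<le> c + x / E" and
    d: "\<And>y. 0 \<le> y \<Longrightarrow> F_A w p q \<gamma>A \<gamma>B (q * y - p) \<le> d + q * y / D" and
    sum: "c + d + ramp_mean_A p h D / E + q * ramp_mean_B p q h E / D = 1"
    by blast
  show thesis
  proof (rule that[of "w * c" "w * d"])
    show "w * F_B w p q \<gamma>A \<gamma>B ((x + p) / q) \<le> w * c + 1 / \<gamma>A * x" if "0 \<le> x" for x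
      using mult_left_mono[OF c[OF that], of w] pos by (simp add: E distrib_left)
    show "w * F_A w p q \<gamma>A \<gamma>B (q * y - p) \<le> w * d + 1 / \<gamma>B * y" if "0 \<le> y" for y
      using mult_left_mono[OF d[OF that], of w] pos by (simp add: D distrib_left)
    have "w * c + w * d + ramp_mean_A p h D / \<gamma>A + ramp_mean_B p q h E / \<gamma>B =
        w * (c + d + ramp_mean_A p h D / E + q * ramp_mean_B p q h E / D)"
      using pos by (simp add: D E distrib_left)
    then show "w * c + w * d + ramp_mean_A p h D / \<gamma>A + ramp_mean_B p q h E / \<gamma>B = w"
      using sum by simp
  qed
qed

end

section \<open>Payoff bounds for arbitrary, possibly correlated, strategies\<close>

lemma lotto_beta_bounds:
  assumes "0 \<le> \<alpha>" "\<alpha> \<le> 1"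
  shows "0 \<le> lotto_beta \<alpha> x y" "lotto_beta \<alpha> x y \<le> 1"
  using assms by (auto simp: lotto_beta_def)

lemma measurable_lotto_beta [measurable]:
  assumes [measurable]: "f \<in> borel_measurable M" "g \<in> borel_measurable M"
  shows "(\<lambda>x. lotto_beta \<alpha> (f x) (g x)) \<in> borel_measurable M"
  unfolding lotto_beta_def by measurable

text \<open>The expectation of a separable affine bound depends on the joint law only through the
  means of its coordinates, and the budget controls their sum. The finite budget also makes every
  coordinate integrable.\<close>

lemma lotto_strategies_integral_affine_le:
  assumes M: "M \<in> lotto_strategies n X" and X: "0 \<le> X" and k: "0 \<le> k"
    and u: "integrable M u"
    and le: "\<And>x. \<forall>i\<in>{1..n}. 0 \<le> x i \<Longrightarrow> u x \<le> (\<Sum>i\<in>{1..n}. c i + k * x i)"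
  shows "(\<integral>x. u x \<partial>M) \<le> (\<Sum>i\<in>{1..n}. c i) + k * X"
proof -
  from M have "prob_space M"
    and sets [measurable_cong]: "sets M = sets (\<Pi>\<^sub>M i\<in>{1..n}. (borel :: real measure))"
    and nonneg: "AE x in M. \<forall>i\<in>{1..n}. 0 \<le> x i"
    and budget: "(\<Sum>i\<in>{1..n}. \<integral>\<^sup>+ t. ennreal t \<partial>distr M borel (\<lambda>x. x i)) \<le> ennreal X"
    by (auto simp: lotto_strategies_def)
  interpret prob_space M by fact
  have coord [measurable]: "(\<lambda>x. x i) \<in> borel_measurable M" if "i \<in> {1..n}" for i
    using that by measurable
  have budget': "(\<Sum>i\<in>{1..n}. \<integral>\<^sup>+ x. ennreal (x i) \<partial>M) \<le> ennreal X"
    using budget by (simp add: nn_integral_distr)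
  have nn: "AE x in M. 0 \<le> x i" if "i \<in> {1..n}" for i
    using nonneg that by auto
  have int: "integrable M (\<lambda>x. x i)" if i: "i \<in> {1..n}" for i
  proof (rule integrableI_nonneg[OF coord[OF i] nn[OF i]])
    have "(\<integral>\<^sup>+ x. ennreal (x i) \<partial>M) \<le> (\<Sum>i\<in>{1..n}. \<integral>\<^sup>+ x. ennreal (x i) \<partial>M)"
      using i by (intro member_le_sum) auto
    also note budget'
    finally show "(\<integral>\<^sup>+ x. ennreal (x i) \<partial>M) < \<infinity>"
      by (simp add: le_less_trans)
  qed
  have "ennreal (\<Sum>i\<in>{1..n}. \<integral>x. x i \<partial>M) = (\<Sum>i\<in>{1..n}. \<integral>\<^sup>+ x. ennreal (x i) \<partial>M)"
    using nn by (subst sum_ennreal[symmetric])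
      (auto intro!: sum.cong nn_integral_eq_integral[symmetric] int integral_nonneg_AE)
  with budget' have mean_le: "(\<Sum>i\<in>{1..n}. \<integral>x. x i \<partial>M) \<le> X"
    using X by (metis ennreal_le_iff)
  have "integrable M (\<lambda>x. \<Sum>i\<in>{1..n}. c i + k * x i)"
    by (intro Bochner_Integration.integrable_sum Bochner_Integration.integrable_add
        integrable_const integrable_mult_right int)
  then have "(\<integral>x. u x \<partial>M) \<le> (\<integral>x. (\<Sum>i\<in>{1..n}. c i + k * x i) \<partial>M)"
    using nonneg le by (intro integral_mono_AE u) auto
  also have "\<dots> = (\<Sum>i\<in>{1..n}. c i) + k * (\<Sum>i\<in>{1..n}. \<integral>x. x i \<partial>M)"
    by (subst Bochner_Integration.integral_sum)
      (auto simp: int sum.distrib sum_distrib_left prob_space simp del: One_nat_def)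
  also have "\<dots> \<le> (\<Sum>i\<in>{1..n}. c i) + k * X"
    using mean_le k by (simp add: mult_left_mono)
  finally show ?thesis .
qed

text \<open>Fubini with the responder's allocation \<open>x\<close> held fixed: against a product
  law the inner integral splits into one-dimensional integrals over the \<open>D i\<close>, each
  below a line in \<open>x i\<close>. The kernel \<open>\<phi>\<close> is kept abstract so that both
  players can be the responder.\<close>

lemma response_payoff_le:
  fixes D :: "nat \<Rightarrow> real measure" and \<phi> :: "nat \<Rightarrow> real \<Rightarrow> real \<Rightarrow> real"
  assumes M: "M \<in> lotto_strategies n X" and X: "0 \<le> X" and k: "0 \<le> k"
    and D: "\<And>i. i \<in> {1..n} \<Longrightarrow> real_distribution (D i)"
    and \<phi> [measurable]: "\<And>i. (\<lambda>z. \<phi> i (fst z) (snd z)) \<in> borel_measurable (borel \<Otimes>\<^sub>M borel)"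
    and bounds: "\<And>i x y. i \<in> {1..n} \<Longrightarrow> 0 \<le> \<phi> i x y" "\<And>i x y. i \<in> {1..n} \<Longrightarrow> \<phi> i x y \<le> W i"
    and le: "\<And>i x. i \<in> {1..n} \<Longrightarrow> 0 \<le> x \<Longrightarrow> (\<integral>y. \<phi> i x y \<partial>D i) \<le> c i + k * x"
  shows "(\<integral>(x, y). (\<Sum>i\<in>{1..n}. \<phi> i (x i) (y i)) \<partial>(M \<Otimes>\<^sub>M (\<Pi>\<^sub>M i\<in>{1..n}. D i)))
      \<le> (\<Sum>i\<in>{1..n}. c i) + k * X"
proof -
  let ?N = "\<Pi>\<^sub>M i\<in>{1..n}. D i"
  from M have "prob_space M"
    and sets_M [measurable_cong]: "sets M = sets (\<Pi>\<^sub>M i\<in>{1..n}. (borel :: real measure))"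
    by (auto simp: lotto_strategies_def)
  have prob_D: "prob_space (D i)" and sets_D: "sets (D i) = sets borel" if "i \<in> {1..n}" for i
    using D[OF that] by (auto simp: real_distribution_def real_distribution_axioms_def)
  have sets_N [measurable_cong]: "sets ?N = sets (\<Pi>\<^sub>M i\<in>{1..n}. (borel :: real measure))"
    by (intro sets_PiM_cong) (auto simp: sets_D)
  interpret M: prob_space M by fact
  interpret N: prob_space ?N by (intro prob_space_PiM prob_D)
  interpret P: pair_prob_space M ?N ..
  have meas [measurable]: "(\<lambda>(x, y). \<phi> i (x i) (y i)) \<in> borel_measurable (M \<Otimes>\<^sub>M ?N)"
    if [simp]: "i \<in> {1..n}" for i
  proof -
    have [measurable]: "(\<lambda>x. x i) \<in> borel_measurable M" "(\<lambda>y. y i) \<in> borel_measurable ?N"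
      using that by (simp_all cong: measurable_cong_sets[OF sets_M] measurable_cong_sets[OF sets_N])
    have "(\<lambda>z. (fst z i, snd z i)) \<in> measurable (M \<Otimes>\<^sub>M ?N) (borel \<Otimes>\<^sub>M borel)"
      by measurable
    from measurable_compose[OF this \<phi>[of i]] show ?thesis
      by (simp add: split_beta')
  qed
  have int: "integrable (M \<Otimes>\<^sub>M ?N) (\<lambda>(x, y). \<phi> i (x i) (y i))" if "i \<in> {1..n}" for i
    using bounds[OF that] that
    by (intro P.integrable_const_bound[of _ "W i"] meas) auto
  have int_sum: "integrable (M \<Otimes>\<^sub>M ?N) (\<lambda>(x, y). \<Sum>i\<in>{1..n}. \<phi> i (x i) (y i))"
    using int by (auto simp: split_beta' intro!: Bochner_Integration.integrable_sum)
  have slice: "(\<lambda>y. \<phi> i x y) \<in> borel_measurable borel" for i x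
    using measurable_compose[OF measurable_Pair1' \<phi>[of i], of x] by simp
  have inner: "(\<integral>y. \<phi> i x (y i) \<partial>?N) = (\<integral>y. \<phi> i x y \<partial>D i)" if i: "i \<in> {1..n}" for i x
  proof -
    have "(\<integral>y. \<phi> i x (y i) \<partial>?N) = (\<integral>y. \<phi> i x y \<partial>distr ?N (D i) (\<lambda>y. y i))"
      using slice measurable_component_singleton[OF i, of D]
      by (intro integral_distr[symmetric]) (simp_all cong: measurable_cong_sets add: sets_D[OF i])
    also have "distr ?N (D i) (\<lambda>y. y i) = D i"
      by (intro distr_PiM_component prob_D i)
    finally show ?thesis .
  qed
  have int_inner: "integrable ?N (\<lambda>y. \<phi> i x (y i))" if i: "i \<in> {1..n}" for i x
  proof (rule N.integrable_const_bound[of _ "W i"])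
    have "(\<lambda>y. y i) \<in> borel_measurable ?N"
      using measurable_component_singleton[OF i, of D] by (simp cong: measurable_cong_sets add: sets_D[OF i])
    then show "(\<lambda>y. \<phi> i x (y i)) \<in> borel_measurable ?N"
      by (rule measurable_compose[OF _ slice])
  qed (use bounds[OF i] in auto)
  have "(\<integral>(x, y). (\<Sum>i\<in>{1..n}. \<phi> i (x i) (y i)) \<partial>(M \<Otimes>\<^sub>M ?N)) =
      (\<integral>x. (\<integral>y. (\<Sum>i\<in>{1..n}. \<phi> i (x i) (y i)) \<partial>?N) \<partial>M)"
    by (rule P.integral_fst[OF int_sum, symmetric])
  also have "\<dots> \<le> (\<Sum>i\<in>{1..n}. c i) + k * X"
  proof (rule lotto_strategies_integral_affine_le[OF M X k P.integrable_fst[OF int_sum]])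
    fix x :: "nat \<Rightarrow> real" assume x: "\<forall>i\<in>{1..n}. 0 \<le> x i"
    have "(\<integral>y. (\<Sum>i\<in>{1..n}. \<phi> i (x i) (y i)) \<partial>?N) = (\<Sum>i\<in>{1..n}. \<integral>y. \<phi> i (x i) y \<partial>D i)"
      by (subst Bochner_Integration.integral_sum) (auto simp: int_inner inner simp del: One_nat_def)
    also have "\<dots> \<le> (\<Sum>i\<in>{1..n}. c i + k * x i)"
      using x le by (intro sum_mono) auto
    finally show "(\<integral>y. (\<Sum>i\<in>{1..n}. \<phi> i (x i) (y i)) \<partial>?N) \<le> (\<Sum>i\<in>{1..n}. c i + k * x i)" .
  qed
  finally show ?thesis .
qed

section \<open>Feasibility of independent allocations\<close>

lemma independent_allocation_lotto_strategies:
  assumes rd: "\<And>i. i \<in> {1..n} \<Longrightarrow> real_distribution (interval_measure (F i))"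
    and cdf: "\<And>i. i \<in> {1..n} \<Longrightarrow> cdf (interval_measure (F i)) = F i"
    and neg: "\<And>i x. i \<in> {1..n} \<Longrightarrow> x < 0 \<Longrightarrow> F i x = 0"
    and mean: "\<And>i. i \<in> {1..n} \<Longrightarrow> (\<integral>\<^sup>+ x. ennreal x \<partial>interval_measure (F i)) = ennreal (m i)"
    and m: "\<And>i. i \<in> {1..n} \<Longrightarrow> 0 \<le> m i" "(\<Sum>i\<in>{1..n}. m i) \<le> X"
  shows "independent_allocation n F \<in> lotto_strategies n X"
proof -
  let ?N = "independent_allocation n F"
  have prob: "prob_space (interval_measure (F i))" if "i \<in> {1..n}" for i
    using rd[OF that] by (simp add: real_distribution_def)
  have sets: "sets ?N = sets (\<Pi>\<^sub>M i\<in>{1..n}. (borel :: real measure))"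
    unfolding independent_allocation_def by (intro sets_PiM_cong) auto
  have AE1: "AE x in interval_measure (F i). 0 \<le> x" if i: "i \<in> {1..n}" for i
  proof -
    interpret real_distribution "interval_measure (F i)" by (rule rd[OF i])
    \<comment> \<open>The left limit of the distribution function at \<open>0\<close> is the mass of
      the negative half-line.\<close>
    have "(cdf (interval_measure (F i)) \<longlongrightarrow> measure (interval_measure (F i)) {..<0}) (at_left 0)"
      by (rule cdf_at_left)
    moreover have "(cdf (interval_measure (F i)) \<longlongrightarrow> 0) (at_left 0)"
      unfolding cdf[OF i]
      by (rule tendsto_eventually) (auto simp: eventually_at_left_field neg[OF i] intro!: exI[of _ "-1"])
    ultimately have "measure (interval_measure (F i)) {..<0} = 0"
      using tendsto_unique trivial_limit_at_left_real by blast
    then have "{..<0} \<in> null_sets (interval_measure (F i))"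
      by (auto simp: null_sets_def emeasure_eq_measure)
    then show ?thesis
      by (rule AE_I') auto
  qed
  have AE: "AE x in ?N. 0 \<le> x i" if i: "i \<in> {1..n}" for i
    unfolding independent_allocation_def
    by (rule AE_PiM_component[where P = "\<lambda>t. 0 \<le> t"]) (use prob i AE1[OF i] in \<open>auto simp del: One_nat_def\<close>)
  have marginal: "distr ?N borel (\<lambda>x. x i) = interval_measure (F i)" if i: "i \<in> {1..n}" for i
  proof -
    have "distr ?N borel (\<lambda>x. x i) = distr ?N (interval_measure (F i)) (\<lambda>x. x i)"
      by (rule distr_cong) auto
    also have "\<dots> = interval_measure (F i)"
      unfolding independent_allocation_def by (rule distr_PiM_component[OF prob i])
    finally show ?thesis .
  qed
  have "(\<Sum>i\<in>{1..n}. \<integral>\<^sup>+ t. ennreal t \<partial>distr ?N borel (\<lambda>x. x i)) = (\<Sum>i\<in>{1..n}. ennreal (m i))"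
    by (intro sum.cong refl) (simp only: marginal mean)
  also have "\<dots> = ennreal (\<Sum>i\<in>{1..n}. m i)"
    by (rule sum_ennreal) (rule m)
  also have "\<dots> \<le> ennreal X"
    using m(2) by (rule ennreal_leI)
  finally have "(\<Sum>i\<in>{1..n}. \<integral>\<^sup>+ t. ennreal t \<partial>distr ?N borel (\<lambda>x. x i)) \<le> ennreal X" .
  moreover have "prob_space ?N"
    unfolding independent_allocation_def by (intro prob_space_PiM prob)
  moreover have "AE x in ?N. \<forall>i\<in>{1..n}. 0 \<le> x i"
    by (intro eventually_ball_finite ballI AE) auto
  ultimately show ?thesis
    using sets by (simp add: lotto_strategies_def)
qed

section \<open>Exhausted budgets, and the equilibrium from the two payoff bounds\<close>

theorem corollary5p2:
  fixes n :: nat and XA XB \<alpha> \<gamma>A \<gamma>B :: real and w p q :: "nat \<Rightarrow> real"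
  assumes "lotto_game n XA XB \<alpha> w p q"
    and "\<gamma>A > 0" and "\<gamma>B > 0"
    and "g_A n XB w p q \<gamma>A \<gamma>B = 0"
    and "g_B n XA w p q \<gamma>A \<gamma>B = 0"
  shows "lotto_equilibrium n XA XB \<alpha> w p q
           (independent_allocation n (\<lambda>i. F_A (w i) (p i) (q i) \<gamma>A \<gamma>B))
           (independent_allocation n (\<lambda>i. F_B (w i) (p i) (q i) \<gamma>A \<gamma>B))"
proof -
  let ?FA = "\<lambda>i. F_A (w i) (p i) (q i) \<gamma>A \<gamma>B" and ?FB = "\<lambda>i. F_B (w i) (p i) (q i) \<gamma>A \<gamma>B"
  let ?MA = "independent_allocation n ?FA" and ?MB = "independent_allocation n ?FB"
  let ?D = "\<lambda>i. q i * w i * \<gamma>B" and ?E = "\<lambda>i. w i * \<gamma>A"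
  let ?h = "lotto_h w p q \<gamma>A \<gamma>B"
  have pos: "w i > 0" "q i > 0" "\<gamma>A > 0" "\<gamma>B > 0" if "i \<in> {1..n}" for i
    using assms that by (auto simp: lotto_game_def)
  have XA: "0 < XA" and XB: "0 < XB" and \<alpha>: "0 \<le> \<alpha>" "\<alpha> \<le> 1"
    using assms(1) by (auto simp: lotto_game_def)
  define eA where "eA i = ramp_mean_A (p i) (?h i) (?D i)" for i
  define eB where "eB i = ramp_mean_B (p i) (q i) (?h i) (?E i)" for i
  note field = pos refl refl lotto_h_def[of w p q \<gamma>A \<gamma>B]
  \<comment> \<open>A battlefield outside both index sets is uncontested, and the sign of
    \<open>p i\<close> makes the sets disjoint. The converse, that their members are contested, is
    \<open>active\<close>.\<close>
  have sum_split: "(\<Sum>i\<in>{1..n}. f i) = (\<Sum>i\<in>I_plus n w p q \<gamma>B. f i) + (\<Sum>i\<in>I_minus n w p \<gamma>A. f i)"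
    if "\<And>i. i \<in> {1..n} \<Longrightarrow> ?h i \<le> max 0 (p i) \<Longrightarrow> f i = 0" for f :: "nat \<Rightarrow> real"
  proof -
    have "(\<Sum>i\<in>{1..n}. f i) = (\<Sum>i\<in>I_plus n w p q \<gamma>B \<union> I_minus n w p \<gamma>A. f i)"
    proof (rule sum.mono_neutral_right)
      show "\<forall>i\<in>{1..n} - (I_plus n w p q \<gamma>B \<union> I_minus n w p \<gamma>A). f i = 0"
      proof
        fix i assume i: "i \<in> {1..n} - (I_plus n w p q \<gamma>B \<union> I_minus n w p \<gamma>A)"
        then have "?h i \<le> max 0 (p i)"
          using pos[of i] by (auto simp: I_plus_def I_minus_def lotto_h_def field_simps)
        then show "f i = 0" using that i by blast
      qed
    qed (auto simp: I_plus_def I_minus_def)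
    also have "\<dots> = (\<Sum>i\<in>I_plus n w p q \<gamma>B. f i) + (\<Sum>i\<in>I_minus n w p \<gamma>A. f i)"
      by (rule sum.union_disjoint) (auto simp: I_plus_def I_minus_def)
    finally show ?thesis .
  qed
  have active: "max 0 (p i) < ?h i \<and> w i \<noteq> 0 \<and> q i \<noteq> 0"
    if "i \<in> I_plus n w p q \<gamma>B \<or> i \<in> I_minus n w p \<gamma>A" for i
  proof -
    have i: "i \<in> {1..n}" using that by (auto simp: I_plus_def I_minus_def)
    then have "0 < q i * w i * \<gamma>B" "0 < w i * \<gamma>A"
      "\<gamma>B > p i / (q i * w i) \<longleftrightarrow> q i * w i * \<gamma>B > p i" "\<gamma>A > - p i / w i \<longleftrightarrow> w i * \<gamma>A > - p i"
      using pos[OF i] by (simp_all add: field_simps)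
    with that pos[OF i] show ?thesis
      unfolding I_plus_def I_minus_def lotto_h_def by (auto simp del: mult_pos_pos)
  qed
  have active_plus: "max 0 (p i) < ?h i \<and> 0 \<le> p i \<and> w i \<noteq> 0 \<and> q i \<noteq> 0"
    if "i \<in> I_plus n w p q \<gamma>B" for i
    using active[of i] that by (auto simp: I_plus_def)
  have active_minus: "max 0 (p i) < ?h i \<and> p i < 0 \<and> w i \<noteq> 0 \<and> q i \<noteq> 0"
    if "i \<in> I_minus n w p \<gamma>A" for i
    using active[of i] that by (auto simp: I_minus_def)
  \<comment> \<open>The roles cross: \<open>g_B\<close> fixes the spending of A and
    \<open>g_A\<close> that of B. The factor \<open>\<gamma>B\<close> cancels against the one in
    \<open>2 * ?D i\<close> and leaves the summands of \<open>g_B\<close>.\<close>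
  have sum_eA: "(\<Sum>i\<in>{1..n}. eA i) = XA"
  proof -
    have "\<gamma>B * (\<Sum>i\<in>{1..n}. eA i) = (\<Sum>i\<in>{1..n}. \<gamma>B * eA i)"
      by (rule sum_distrib_left)
    also have "\<dots> = (\<Sum>i\<in>I_plus n w p q \<gamma>B. \<gamma>B * eA i) + (\<Sum>i\<in>I_minus n w p \<gamma>A. \<gamma>B * eA i)"
      by (rule sum_split) (simp add: eA_def ramp_mean_A_def)
    also have "(\<Sum>i\<in>I_plus n w p q \<gamma>B. \<gamma>B * eA i) =
        (\<Sum>i\<in>I_plus n w p q \<gamma>B. (?h i - p i)\<^sup>2 / (2 * q i * w i))"
      using assms(3)
      by (intro sum.cong refl) (auto simp: eA_def ramp_mean_A_def dest!: active_plus)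
    also have "(\<Sum>i\<in>I_minus n w p \<gamma>A. \<gamma>B * eA i) =
        (\<Sum>i\<in>I_minus n w p \<gamma>A. ((?h i - p i)\<^sup>2 - (p i)\<^sup>2) / (2 * q i * w i))"
      using assms(3)
      by (intro sum.cong refl) (auto simp: eA_def ramp_mean_A_def dest!: active_minus)
    finally show ?thesis
      using assms(3,5) by (simp add: g_B_def)
  qed
  have sum_eB: "(\<Sum>i\<in>{1..n}. eB i) = XB"
  proof -
    have "\<gamma>A * (\<Sum>i\<in>{1..n}. eB i) = (\<Sum>i\<in>{1..n}. \<gamma>A * eB i)"
      by (rule sum_distrib_left)
    also have "\<dots> = (\<Sum>i\<in>I_plus n w p q \<gamma>B. \<gamma>A * eB i) + (\<Sum>i\<in>I_minus n w p \<gamma>A. \<gamma>A * eB i)"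
      by (rule sum_split) (simp add: eB_def ramp_mean_B_def)
    also have "(\<Sum>i\<in>I_plus n w p q \<gamma>B. \<gamma>A * eB i) =
        (\<Sum>i\<in>I_plus n w p q \<gamma>B. ((?h i)\<^sup>2 - (p i)\<^sup>2) / (2 * q i * w i))"
      using assms(2)
      by (intro sum.cong refl) (auto simp: eB_def ramp_mean_B_def dest!: active_plus)
    also have "(\<Sum>i\<in>I_minus n w p \<gamma>A. \<gamma>A * eB i) =
        (\<Sum>i\<in>I_minus n w p \<gamma>A. (?h i)\<^sup>2 / (2 * q i * w i))"
      using assms(2)
      by (intro sum.cong refl) (auto simp: eB_def ramp_mean_B_def dest!: active_minus)
    finally show ?thesis
      using assms(2,4) by (simp add: g_A_def)
  qed
  have MA: "?MA \<in> lotto_strategies n XA"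
    using F_A_cdf[OF pos] nn_integral_F_A[OF field] ramp_mean_A_nonneg[OF field] sum_eA
    by (intro independent_allocation_lotto_strategies[of _ _ eA]) (auto simp: F_A_def eA_def)
  have MB: "?MB \<in> lotto_strategies n XB"
    using F_B_cdf[OF pos] nn_integral_F_B[OF field] ramp_mean_B_nonneg[OF field] sum_eB
    by (intro independent_allocation_lotto_strategies[of _ _ eB]) (auto simp: F_B_def eB_def)
  have "\<exists>cA cB. (\<forall>x\<ge>0. w i * ?FB i ((x + p i) / q i) \<le> cA + 1 / \<gamma>A * x) \<and>
      (\<forall>y\<ge>0. w i * ?FA i (q i * y - p i) \<le> cB + 1 / \<gamma>B * y) \<and>
      cA + cB + eA i / \<gamma>A + eB i / \<gamma>B = w i" if i: "i \<in> {1..n}" for i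
    unfolding eA_def eB_def by (rule affine_majorants[OF field, OF i i i i]) blast
  then obtain cA cB where
    cA: "\<And>i x. i \<in> {1..n} \<Longrightarrow> 0 \<le> x \<Longrightarrow> w i * ?FB i ((x + p i) / q i) \<le> cA i + 1 / \<gamma>A * x" and
    cB: "\<And>i y. i \<in> {1..n} \<Longrightarrow> 0 \<le> y \<Longrightarrow> w i * ?FA i (q i * y - p i) \<le> cB i + 1 / \<gamma>B * y" and
    c_sum: "\<And>i. i \<in> {1..n} \<Longrightarrow> cA i + cB i + eA i / \<gamma>A + eB i / \<gamma>B = w i"
    by metis
  \<comment> \<open>Intercepts plus multiplier times budget: the most that a feasible strategy can
    collect under the affine bounds.\<close>
  define V where "V = (\<Sum>i\<in>{1..n}. cA i) + 1 / \<gamma>A * XA"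
  define U where "U = (\<Sum>i\<in>{1..n}. cB i) + 1 / \<gamma>B * XB"
  have VU: "V + U = (\<Sum>i\<in>{1..n}. w i)"
  proof -
    have "(\<Sum>i\<in>{1..n}. w i) = (\<Sum>i\<in>{1..n}. cA i + cB i + eA i / \<gamma>A + eB i / \<gamma>B)"
      using c_sum by simp
    also have "\<dots> = V + U"
      \<comment> \<open>Both budgets are replaced by the sums of the candidates' means, after which
        the identities per battlefield add up.\<close>
      by (simp add: V_def U_def sum.distrib sum_eA[symmetric] sum_eB[symmetric] sum_divide_distrib)
    finally show ?thesis by simp
  qed
  have A_le: "payoff_A n \<alpha> w p q M ?MB \<le> V" if M: "M \<in> lotto_strategies n XA" for M
    unfolding payoff_A_def V_def independent_allocation_def
  proof (rule response_payoff_le[OF M, where W = w])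
    fix i :: nat and x :: real assume i: "i \<in> {1..n}" and x: "0 \<le> x"
    interpret real_distribution "interval_measure (?FB i)"
      using F_B_cdf[OF pos[OF i]] by blast
    \<comment> \<open>Counting a tie as a full win for A only raises the integral, as
      \<open>\<alpha> \<le> 1\<close>. The event becomes the closed half-line
      \<open>y \<le> (x + p i) / q i\<close>, whose mass is a value of the distribution
      function.\<close>
    have "(\<integral>y. w i * lotto_beta \<alpha> x (q i * y - p i) \<partial>interval_measure (?FB i))
        \<le> (\<integral>y. w i * indicator {..(x + p i) / q i} y \<partial>interval_measure (?FB i))"
      using pos[OF i] \<alpha>
      by (intro integral_mono integrable_const_bound[of _ "w i"])
        (auto simp: lotto_beta_def field_simps split: split_indicator)
    also have "\<dots> = w i * ?FB i ((x + p i) / q i)"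
      using F_B_cdf[OF pos[OF i]] by (simp add: cdf_def2[symmetric])
    also note cA[OF i x]
    finally show "(\<integral>y. w i * lotto_beta \<alpha> x (q i * y - p i) \<partial>interval_measure (?FB i))
        \<le> cA i + 1 / \<gamma>A * x" .
  qed (use pos XA assms(2) F_B_cdf lotto_beta_bounds[OF \<alpha>] in
      \<open>auto simp: mult_left_le less_imp_le simp del: One_nat_def\<close>)
  have B_le: "payoff_B n \<alpha> w p q ?MA M \<le> U" if M: "M \<in> lotto_strategies n XB" for M
  proof -
    interpret A: prob_space ?MA using MA by (simp add: lotto_strategies_def)
    interpret M: prob_space M using M by (simp add: lotto_strategies_def)
    interpret P: pair_prob_space ?MA M ..
    have sets_MA [measurable_cong]: "sets ?MA = sets (\<Pi>\<^sub>M i\<in>{1..n}. (borel :: real measure))"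
      and sets_M [measurable_cong]: "sets M = sets (\<Pi>\<^sub>M i\<in>{1..n}. (borel :: real measure))"
      using MA M by (auto simp: lotto_strategies_def)
    let ?f = "\<lambda>(x, y). \<Sum>i\<in>{1..n}. w i * (1 - lotto_beta \<alpha> (x i) (q i * y i - p i))"
    have "?f \<in> borel_measurable (?MA \<Otimes>\<^sub>M M)"
      by measurable
    \<comment> \<open>The response bound expects the arbitrary strategy in the first factor, so the
      factors are exchanged.\<close>
    from P.integral_product_swap[OF this]
    have "payoff_B n \<alpha> w p q ?MA M =
        (\<integral>(y, x). (\<Sum>i\<in>{1..n}. w i * (1 - lotto_beta \<alpha> (x i) (q i * y i - p i))) \<partial>(M \<Otimes>\<^sub>M ?MA))"
      by (simp add: payoff_B_def)
    also have "\<dots> \<le> U"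
      unfolding U_def independent_allocation_def
    proof (rule response_payoff_le[OF M, where W = w])
      fix i :: nat and y :: real assume i: "i \<in> {1..n}" and y: "0 \<le> y"
      interpret real_distribution "interval_measure (?FA i)"
        using F_A_cdf[OF pos[OF i]] by blast
      \<comment> \<open>Now ties count fully for B, which is an upper bound because
        \<open>\<alpha> \<ge> 0\<close>.\<close>
      have "(\<integral>x. w i * (1 - lotto_beta \<alpha> x (q i * y - p i)) \<partial>interval_measure (?FA i))
          \<le> (\<integral>x. w i * indicator {..q i * y - p i} x \<partial>interval_measure (?FA i))"
        using pos[OF i] \<alpha>
        by (intro integral_mono integrable_const_bound[of _ "w i"])
          (auto simp: lotto_beta_def split: split_indicator)
      also have "\<dots> = w i * ?FA i (q i * y - p i)"
        using F_A_cdf[OF pos[OF i]] by (simp add: cdf_def2[symmetric])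
      also note cB[OF i y]
      finally show "(\<integral>x. w i * (1 - lotto_beta \<alpha> x (q i * y - p i)) \<partial>interval_measure (?FA i))
          \<le> cB i + 1 / \<gamma>B * y" .
    qed (use pos XB assms(3) F_A_cdf lotto_beta_bounds[OF \<alpha>] in
      \<open>auto simp: mult_left_le less_imp_le simp del: One_nat_def\<close>)
    finally show ?thesis .
  qed
  \<comment> \<open>The two payoffs add up to the total value in every outcome, ties
    included.\<close>
  have sum_payoffs: "payoff_A n \<alpha> w p q ?MA ?MB + payoff_B n \<alpha> w p q ?MA ?MB = V + U"
  proof -
    interpret A: prob_space ?MA using MA by (simp add: lotto_strategies_def)
    interpret B: prob_space ?MB using MB by (simp add: lotto_strategies_def)
    interpret P: pair_prob_space ?MA ?MB ..
    have sets_MA [measurable_cong]: "sets ?MA = sets (\<Pi>\<^sub>M i\<in>{1..n}. (borel :: real measure))"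
      and sets_MB [measurable_cong]: "sets ?MB = sets (\<Pi>\<^sub>M i\<in>{1..n}. (borel :: real measure))"
      using MA MB by (auto simp: lotto_strategies_def)
    let ?f = "\<lambda>z. \<Sum>i\<in>{1..n}. w i * lotto_beta \<alpha> (fst z i) (q i * snd z i - p i)"
    have int: "integrable (?MA \<Otimes>\<^sub>M ?MB) ?f"
    proof (rule P.integrable_const_bound)
      show "AE z in ?MA \<Otimes>\<^sub>M ?MB. norm (?f z) \<le> (\<Sum>i\<in>{1..n}. w i)"
        using pos lotto_beta_bounds[OF \<alpha>]
        by (intro AE_I2) (auto intro!: sum_mono order_trans[OF sum_abs] simp: abs_mult abs_of_pos mult_left_le less_imp_le simp del: One_nat_def)
      show "?f \<in> borel_measurable (?MA \<Otimes>\<^sub>M ?MB)" by measurable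
    qed
    have "payoff_B n \<alpha> w p q ?MA ?MB = (\<integral>z. (\<Sum>i\<in>{1..n}. w i) - ?f z \<partial>(?MA \<Otimes>\<^sub>M ?MB))"
      by (simp add: payoff_B_def split_beta' right_diff_distrib sum_subtractf)
    also have "\<dots> = (\<Sum>i\<in>{1..n}. w i) - (\<integral>z. ?f z \<partial>(?MA \<Otimes>\<^sub>M ?MB))"
      using int by (subst Bochner_Integration.integral_diff) (auto simp: P.prob_space)
    also have "(\<integral>z. ?f z \<partial>(?MA \<Otimes>\<^sub>M ?MB)) = payoff_A n \<alpha> w p q ?MA ?MB"
      by (simp add: payoff_A_def split_beta')
    finally show ?thesis using VU by simp
  qed
  \<comment> \<open>Two upper bounds whose sum is attained must both be equalities.\<close>
  have "payoff_A n \<alpha> w p q ?MA ?MB = V" "payoff_B n \<alpha> w p q ?MA ?MB = U"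
    using A_le[OF MA] B_le[OF MB] sum_payoffs by linarith+
  then show ?thesis
    using MA MB A_le B_le by (simp add: lotto_equilibrium_def)
qed

end
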